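(* Let $\mathcal{A}$ be a deformation of a graphical arrangement in $V_{n-1}$. Then the regions of $\mathcal{A}$ are in bijection, by assigning to each region its associated weighted digraph, with the valid $m$-acyclic weighted digraphs on $\{1,2,\ldots,n\}$, in such a way that bounded regions correspond to strongly connected valid $m$-acyclic weighted digraphs.
   Context: $V_{n-1}=\{x\in\mathbb{R}^n: x_1+\cdots+x_n=0\}$. Let $G$ be a simple connected undirected graph on the vertex set $\{1,\ldots,n\}$. A deformation of the graphical arrangement of $G$ is a finite hyperplane arrangement in $V_{n-1}$ consisting of the hyperplanes $$x_i-x_j=a_{ij}^{(1)},a_{ij}^{(2)},\ldots,a_{ij}^{(n_{ij})},\quad 1\le i<j\le n,$$ where the $n_{ij}$ are nonnegative integers, $n_{ij}=0$ if $\{i,j\}$ is not an edge of $G$, and $a_{ij}^{(1)}<\cdots<a_{ij}^{(n_{ij})}$ are real numbers. Its regions are the connected components of the complement in $V_{n-1}$ of the union of the hyperplanes. A weighted digraph on the vertex set $\{1,\ldots,n\}$ is valid (for $\mathcal{A}$) if for each $1\le i<j\le n$ exactly one of the following holds: (1) $n_{ij}=0$ and there is no directed edge between $i$ and $j$; (2) $n_{ij}>0$, there is no edge $i\rightarrow j$, and there is exactly one edge $j\rightarrow i$, of weight $-a_{ij}^{(1)}$; (3) $n_{ij}>0$, there is exactly one edge $i\rightarrow j$, of weight $a_{ij}^{(k)}$, and exactly one edge $j\rightarrow i$, of weight $-a_{ij}^{(k+1)}$, for some $1\le k<n_{ij}$; (4) $n_{ij}>0$, there is exactly one edge $i\rightarrow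 j$, of weight $a_{ij}^{(n_{ij})}$, and there is no edge $j\rightarrow i$. The weighted digraph associated to a region $R$: for each $i<j$ with $n_{ij}>0$, the difference $x_i-x_j$ lies, for all points of $R$, in one and the same interval of $\mathbb{R}\setminus\{a_{ij}^{(1)},\ldots,a_{ij}^{(n_{ij})}\}$; alternative (2) is used if $x_i-x_j<a_{ij}^{(1)}$, alternative (3) if $a_{ij}^{(k)}<x_i-x_j<a_{ij}^{(k+1)}$, alternative (4) if $x_i-x_j>a_{ij}^{(n_{ij})}$. A weighted digraph is $m$-acyclic if it contains no directed cycle whose total weight is nonnegative. *)

theory Defs
  imports "HOL-Analysis.Analysis" "Graph_Theory.Graph_Theory"
begin

text \<open>
  The vertex set {1,...,n} is a finite linearly ordered type \<open>'n\<close>, so n = CARD('n) and R^n is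
  \<open>real ^ 'n\<close>. A deformation is given by the numbers \<open>N i j\<close> (usually n_ij) and \<open>a i j k\<close>
  (usually a_ij^(k), with k counted from 1); only the values with i < j and 1 <= k <= N i j
  are ever used.
\<close>

definition sum_zero_space :: "(real ^ 'n) set" where
  "sum_zero_space = {x. (\<Sum>i\<in>UNIV. x $ i) = 0}"

text \<open>
  Following Graph_Theory, a simple undirected graph is a symmetric loop-free digraph without
  parallel arcs. The name \<open>connected\<close> is also used for topological spaces, hence the qualifier.
\<close>

definition graphical_deformation ::
  "'n::{finite,linorder} pair_pre_digraph \<Rightarrow> ('n \<Rightarrow> 'n \<Rightarrow> nat) \<Rightarrow> ('n \<Rightarrow> 'n \<Rightarrow> nat \<Rightarrow> real) \<Rightarrow> bool"
where
  "graphical_deformation G N a \<longleftrightarrow>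
     pair_graph G \<and> pverts G = UNIV \<and> Digraph_Component.connected (with_proj G) \<and>
     (\<forall>i j. i < j \<longrightarrow>
        ((i, j) \<notin> parcs G \<longrightarrow> N i j = 0) \<and> strict_mono_on {1..N i j} (a i j))"

definition arrangement ::
  "('n::{finite,linorder} \<Rightarrow> 'n \<Rightarrow> nat) \<Rightarrow> ('n \<Rightarrow> 'n \<Rightarrow> nat \<Rightarrow> real) \<Rightarrow> (real ^ 'n::{finite,linorder}) set set"
where
  "arrangement N a =
     {{x \<in> sum_zero_space. x $ i - x $ j = a i j k} | i j k. i < j \<and> k \<in> {1..N i j}}"

definition regions ::
  "('n::{finite,linorder} \<Rightarrow> 'n \<Rightarrow> nat) \<Rightarrow> ('n \<Rightarrow> 'n \<Rightarrow> nat \<Rightarrow> real) \<Rightarrow> (real ^ 'n::{finite,linorder}) set set"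
where
  "regions N a = components (sum_zero_space - \<Union>(arrangement N a))"

text \<open>
  A weighted digraph on the vertex set \<open>UNIV :: 'n set\<close> is the set of its edges; the triple
  \<open>(i, w, j)\<close> is an edge from i to j of weight w. Parallel edges are possible, so that "exactly one
  edge" is a genuine condition. Loops are excluded separately (by \<open>loopfree_digraph\<close>), because
  validity only constrains pairs of distinct vertices.
\<close>

type_synonym 'n weighted_edges = "('n \<times> real \<times> 'n) set"

definition weighted_digraph :: "'n weighted_edges \<Rightarrow> ('n, 'n \<times> real \<times> 'n) pre_digraph" where
  "weighted_digraph D =
     \<lparr>verts = UNIV, arcs = D, tail = (\<lambda>(i, w, j). i), head = (\<lambda>(i, w, j). j)\<rparr>"

definition edge_weight :: "'n \<times> real \<times> 'n \<Rightarrow> real" where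
  "edge_weight = (\<lambda>(i, w, j). w)"

definition weights_between :: "'n weighted_edges \<Rightarrow> 'n \<Rightarrow> 'n \<Rightarrow> real set" where
  "weights_between D i j = {w. (i, w, j) \<in> D}"

text \<open>
  The four alternatives are mutually exclusive, so their disjunction says that exactly one holds.
\<close>

definition valid ::
  "('n::{finite,linorder} \<Rightarrow> 'n \<Rightarrow> nat) \<Rightarrow> ('n \<Rightarrow> 'n \<Rightarrow> nat \<Rightarrow> real) \<Rightarrow> 'n weighted_edges \<Rightarrow> bool"
where
  "valid N a D \<longleftrightarrow> (\<forall>i j. i < j \<longrightarrow>
     (N i j = 0 \<and> weights_between D i j = {} \<and> weights_between D j i = {}) \<or>
     (N i j > 0 \<and> weights_between D i j = {} \<and> weights_between D j i = {- a i j 1}) \<or>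
     (N i j > 0 \<and> (\<exists>k. 1 \<le> k \<and> k < N i j \<and>
        weights_between D i j = {a i j k} \<and> weights_between D j i = {- a i j (k + 1)})) \<or>
     (N i j > 0 \<and> weights_between D i j = {a i j (N i j)} \<and> weights_between D j i = {}))"

definition m_acyclic :: "'n weighted_edges \<Rightarrow> bool" where
  "m_acyclic D \<longleftrightarrow>
     \<not> (\<exists>p. pre_digraph.cycle (weighted_digraph D) p \<and> (\<Sum>e\<leftarrow>p. edge_weight e) \<ge> 0)"

text \<open>
  The three parts are the edges contributed by pairs with \<open>x $ i - x $ j\<close>, on the whole of R,
  below all the a_ij^(k), between two consecutive ones, and above all of them.
\<close>

definition associated_digraph ::
  "('n::{finite,linorder} \<Rightarrow> 'n \<Rightarrow> nat) \<Rightarrow> ('n \<Rightarrow> 'n \<Rightarrow> nat \<Rightarrow> real) \<Rightarrow> (real ^ 'n::{finite,linorder}) set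
    \<Rightarrow> 'n weighted_edges"
where
  "associated_digraph N a R =
     (\<Union>{{(j, - a i j 1, i)} | i j.
          i < j \<and> N i j > 0 \<and> (\<forall>x\<in>R. x $ i - x $ j < a i j 1)}) \<union>
     (\<Union>{{(i, a i j k, j), (j, - a i j (k + 1), i)} | i j k.
          i < j \<and> 1 \<le> k \<and> k < N i j \<and>
          (\<forall>x\<in>R. a i j k < x $ i - x $ j \<and> x $ i - x $ j < a i j (k + 1))}) \<union>
     (\<Union>{{(i, a i j (N i j), j)} | i j.
          i < j \<and> N i j > 0 \<and> (\<forall>x\<in>R. x $ i - x $ j > a i j (N i j))})"

end

theory Submission
  imports Defs
begin

text \<open>
  Read an edge \<open>(i, w, j)\<close> as the strict inequality \<open>w < x $ i - x $ j\<close>, and let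
  \<open>solutions D\<close> be the set of points of the ambient space that satisfy all inequalities of a
  digraph \<open>D\<close>. A valid digraph prescribes, for every pair \<open>i < j\<close>, one of the gaps
  left on the real line by the numbers \<open>a i j k\<close>, and \<open>x\<close> is a solution exactly if
  each difference \<open>x $ i - x $ j\<close> lies in the prescribed gap. Hence every point off the
  hyperplanes solves exactly one loop-free valid digraph. Solution sets are convex, and no connected set can
  leave one without meeting a hyperplane; so the regions are exactly the nonempty solution sets of
  valid digraphs (\<open>regions_eq_solution_sets\<close>), and \<open>solutions\<close> inverts the
  passage from a region to its digraph.

  It remains to see which systems of inequalities are solvable. Summing the inequalities along a
  closed walk gives \<open>weight < 0\<close>, so solvability forces \<open>m\<close>-acyclicity. Conversely, if
  every cycle has negative weight, then this stays true after all weights are raised by a small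
  \<open>\<epsilon> > 0\<close>; the maximal raised weight of a simple path starting at \<open>i\<close> is then a potential
  that exceeds the potential of \<open>j\<close> by at least \<open>w + \<epsilon>\<close> along each edge
  \<open>(i, w, j)\<close> (\<open>m_acyclic_imp_potential\<close>).

  Finally, in a strongly connected digraph walks in both directions bound every difference of
  coordinates, and the coordinates sum to zero, so the solution set is bounded. If some vertex cannot
  be reached from \<open>u\<close>, lowering all coordinates of vertices reachable from \<open>u\<close> and raising
  the others never violates an inequality, which gives a ray of solutions.
\<close>

section \<open>Gaps between the values of a finite increasing sequence\<close>

text \<open>
  Gap number \<open>k\<close> is the interval between \<open>f k\<close> and \<open>f (k + 1)\<close>; the gaps
  \<open>0\<close> and \<open>n\<close> are unbounded. Counting the lower unbounded gap as number 0 turns the four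
  alternatives in the definition of validity into a single one.
\<close>

definition in_gap :: "(nat \<Rightarrow> real) \<Rightarrow> nat \<Rightarrow> nat \<Rightarrow> real \<Rightarrow> bool" where
  "in_gap f n k d \<longleftrightarrow> k \<le> n \<and> (1 \<le> k \<longrightarrow> f k < d) \<and> (k < n \<longrightarrow> d < f (k + 1))"

lemma in_gap_exists:
  assumes "\<forall>k\<in>{1..n}. d \<noteq> f k"
  shows "\<exists>k. in_gap f n k d"
proof -
  have "\<exists>k. in_gap f m k d" if "m \<le> n" for m
    using that
  proof (induction m)
    case 0
    show ?case by (auto simp: in_gap_def)
  next
    case (Suc m)
    then obtain k where k: "in_gap f m k d" by auto
    have "d \<noteq> f (Suc m)" using assms Suc.prems by auto
    then consider "f (Suc m) < d" | "d < f (Suc m)" by linarith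
    then show ?case
    proof cases
      case 1
      then show ?thesis by (intro exI[of _ "Suc m"]) (simp add: in_gap_def)
    next
      case 2
      then show ?thesis using k by (intro exI[of _ k]) (auto simp: in_gap_def less_Suc_eq)
    qed
  qed
  then show ?thesis by blast
qed

lemma in_gap_less_iff:
  assumes mono: "strict_mono_on {1..n} f" and gap: "in_gap f n k d" and l: "l \<in> {1..n}"
  shows "f l < d \<longleftrightarrow> l \<le> k" and "f l \<noteq> d"
proof -
  have low: "f l < d" if "l \<le> k"
  proof -
    have "f l \<le> f k"
      using mono l gap that by (intro strict_mono_on_leD[OF mono]) (auto simp: in_gap_def)
    then show ?thesis using gap l that by (auto simp: in_gap_def)
  qed
  have high: "d < f l" if "\<not> l \<le> k"
  proof -
    have "f (k + 1) \<le> f l"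
      using mono l gap that by (intro strict_mono_on_leD[OF mono]) (auto simp: in_gap_def)
    then show ?thesis using gap l that by (auto simp: in_gap_def)
  qed
  show "f l < d \<longleftrightarrow> l \<le> k" and "f l \<noteq> d" using low high by force+
qed

lemma in_gap_unique:
  assumes mono: "strict_mono_on {1..n} f" and "in_gap f n k d" "in_gap f n k' d"
  shows "k = k'"
proof -
  have le: "l \<le> l'" if "in_gap f n l d" "in_gap f n l' d" for l l'
  proof (cases "l = 0")
    case False
    then have "l \<in> {1..n}" using that by (auto simp: in_gap_def)
    then show ?thesis using in_gap_less_iff(1)[OF mono _ \<open>l \<in> {1..n}\<close>] that by blast
  qed simp
  show ?thesis using le[OF assms(2,3)] le[OF assms(3,2)] by simp
qed

section \<open>Valid digraphs as systems of inequalities\<close>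

abbreviation arrangement_complement ::
  "('n::{finite,linorder} \<Rightarrow> 'n \<Rightarrow> nat) \<Rightarrow> ('n \<Rightarrow> 'n \<Rightarrow> nat \<Rightarrow> real) \<Rightarrow> (real ^ 'n::{finite,linorder}) set"
  where "arrangement_complement N a \<equiv> sum_zero_space - \<Union>(arrangement N a)"

definition solutions :: "'n weighted_edges \<Rightarrow> (real ^ 'n) set" where
  "solutions D = {x \<in> sum_zero_space. \<forall>i w j. (i, w, j) \<in> D \<longrightarrow> w < x $ i - x $ j}"

lemma arrangement_complement_iff:
  "x \<in> arrangement_complement N a \<longleftrightarrow>
     x \<in> sum_zero_space \<and> (\<forall>i j. i < j \<longrightarrow> (\<forall>k\<in>{1..N i j}. x $ i - x $ j \<noteq> a i j k))"
proof -
  have union: "x \<in> \<Union>{S i j k | i j k. P i j k} \<longleftrightarrow> (\<exists>i j k. P i j k \<and> x \<in> S i j k)" for S P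
    by blast
  show ?thesis unfolding arrangement_def Diff_iff union by auto
qed

lemma weighted_digraph_simps [simp]:
  "verts (weighted_digraph D) = UNIV" "arcs (weighted_digraph D) = D"
  "tail (weighted_digraph D) (i, w, j) = i" "head (weighted_digraph D) (i, w, j) = j"
  by (simp_all add: weighted_digraph_def)

lemma loopfree_weighted_digraph_iff:
  "loopfree_digraph (weighted_digraph D) \<longleftrightarrow> (\<forall>i w. (i, w, i) \<notin> D)"
  by (auto simp: loopfree_digraph_def loopfree_digraph_axioms_def wf_digraph_def
      weighted_digraph_def)

lemma wf_weighted_digraph: "wf_digraph (weighted_digraph D)"
  by (simp add: wf_digraph_def weighted_digraph_def)

lemma valid_iff_gaps:
  "valid N a D \<longleftrightarrow> (\<forall>i j. i < j \<longrightarrow> (\<exists>k\<le>N i j.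
     weights_between D i j = (if k = 0 then {} else {a i j k}) \<and>
     weights_between D j i = (if k < N i j then {- a i j (k + 1)} else {})))"
proof -
  have "(n = 0 \<and> A = {} \<and> B = {} \<or>
      n > 0 \<and> A = {} \<and> B = {- f 1} \<or>
      n > 0 \<and> (\<exists>k. 1 \<le> k \<and> k < n \<and> A = {f k} \<and> B = {- f (k + 1)}) \<or>
      n > 0 \<and> A = {f n} \<and> B = {}) \<longleftrightarrow>
    (\<exists>k\<le>n. A = (if k = 0 then {} else {f k}) \<and> B = (if k < n then {- f (k + 1)} else {}))"
    (is "?L \<longleftrightarrow> ?R") for n :: nat and A B :: "real set" and f
  proof
    assume ?L
    then consider "n = 0 \<and> A = {} \<and> B = {}" | "n > 0 \<and> A = {} \<and> B = {- f 1}"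
      | k where "1 \<le> k" "k < n" "A = {f k}" "B = {- f (k + 1)}"
      | "n > 0 \<and> A = {f n} \<and> B = {}" by blast
    then show ?R
    proof cases
      case 3
      then show ?thesis by (intro exI[of _ k]) simp
    qed auto
  next
    assume ?R
    then obtain k where k: "k \<le> n" "A = (if k = 0 then {} else {f k})"
      "B = (if k < n then {- f (k + 1)} else {})" by blast
    then consider "k = 0" "n = 0" | "k = 0" "n > 0" | "1 \<le> k" "k < n" | "k = n" "n > 0" by linarith
    then show ?L using k by cases auto
  qed
  then show ?thesis unfolding valid_def by presburger
qed

lemma valid_gap:
  assumes "valid N a D" and "i < j"
  shows "\<exists>k. weights_between D i j = (if k = 0 then {} else {a i j k}) \<and>
    weights_between D j i = (if k < N i j then {- a i j (k + 1)} else {}) \<and>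
    (\<forall>x\<in>solutions D. in_gap (a i j) (N i j) k (x $ i - x $ j))"
proof -
  obtain k where k: "k \<le> N i j" "weights_between D i j = (if k = 0 then {} else {a i j k})"
    "weights_between D j i = (if k < N i j then {- a i j (k + 1)} else {})"
    using assms unfolding valid_iff_gaps by blast
  have "in_gap (a i j) (N i j) k (x $ i - x $ j)" if "x \<in> solutions D" for x
  proof -
    have "a i j k < x $ i - x $ j" if "1 \<le> k"
      using k(2) that \<open>x \<in> solutions D\<close> by (auto simp: weights_between_def solutions_def)
    moreover have "- a i j (k + 1) < x $ j - x $ i" if "k < N i j"
    proof -
      have "(j, - a i j (k + 1), i) \<in> D" using k(3) that by (auto simp: weights_between_def)
      then show ?thesis using \<open>x \<in> solutions D\<close> unfolding solutions_def by blast
    qed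
    ultimately show ?thesis using k(1) by (fastforce simp: in_gap_def)
  qed
  with k show ?thesis by blast
qed

lemma associated_digraph_iff:
  "(p, w, q) \<in> associated_digraph N a R \<longleftrightarrow>
     q < p \<and> N q p > 0 \<and> w = - a q p 1 \<and> (\<forall>x\<in>R. x $ q - x $ p < a q p 1) \<or>
     p < q \<and> (\<exists>k. 1 \<le> k \<and> k < N p q \<and> w = a p q k \<and>
       (\<forall>x\<in>R. a p q k < x $ p - x $ q \<and> x $ p - x $ q < a p q (k + 1))) \<or>
     q < p \<and> (\<exists>k. 1 \<le> k \<and> k < N q p \<and> w = - a q p (k + 1) \<and>
       (\<forall>x\<in>R. a q p k < x $ q - x $ p \<and> x $ q - x $ p < a q p (k + 1))) \<or>
     p < q \<and> N p q > 0 \<and> w = a p q (N p q) \<and> (\<forall>x\<in>R. x $ p - x $ q > a p q (N p q))"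
proof -
  have low: "(p, w, q) \<in> \<Union>{{(j, - f i j, i)} | i j. P i j} \<longleftrightarrow> P q p \<and> w = - f q p" for P f
    by blast
  have mid: "(p, w, q) \<in> \<Union>{{(i, f i j k, j), (j, - g i j k, i)} | i j k. P i j k} \<longleftrightarrow>
      (\<exists>k. P p q k \<and> w = f p q k) \<or> (\<exists>k. P q p k \<and> w = - g q p k)" for P f g
    by blast
  have high: "(p, w, q) \<in> \<Union>{{(i, f i j, j)} | i j. P i j} \<longleftrightarrow> P p q \<and> w = f p q" for P f
    by blast
  show ?thesis unfolding associated_digraph_def Un_iff low mid high by auto
qed

text \<open>
  The gap with number \<open>k\<close> contributes its lower end as an edge upwards and its upper end as an
  edge downwards; numbering the unbounded gaps \<open>0\<close> and \<open>N i j\<close> merges the two kinds of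
  upward edges into one formula, and likewise the downward ones.
\<close>

lemma associated_digraph_up_iff:
  assumes "i < j"
  shows "(i, w, j) \<in> associated_digraph N a R \<longleftrightarrow>
    (\<exists>k. 1 \<le> k \<and> k \<le> N i j \<and> w = a i j k \<and> (\<forall>x\<in>R. in_gap (a i j) (N i j) k (x $ i - x $ j)))"
    (is "?L \<longleftrightarrow> ?R")
proof -
  have "?L \<longleftrightarrow> (\<exists>k. 1 \<le> k \<and> k < N i j \<and> w = a i j k \<and>
        (\<forall>x\<in>R. a i j k < x $ i - x $ j \<and> x $ i - x $ j < a i j (k + 1))) \<or>
      N i j > 0 \<and> w = a i j (N i j) \<and> (\<forall>x\<in>R. x $ i - x $ j > a i j (N i j))" (is "_ \<longleftrightarrow> ?M \<or> ?T")
    using assms less_not_sym[OF assms] by (simp add: associated_digraph_iff)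
  also have "?M \<longleftrightarrow> (\<exists>k. 1 \<le> k \<and> k < N i j \<and> w = a i j k \<and>
      (\<forall>x\<in>R. in_gap (a i j) (N i j) k (x $ i - x $ j)))"
    by (intro ex_cong1) (auto simp: in_gap_def)
  also have "?T \<longleftrightarrow> (\<exists>k. 1 \<le> k \<and> k = N i j \<and> w = a i j k \<and>
      (\<forall>x\<in>R. in_gap (a i j) (N i j) k (x $ i - x $ j)))"
    by (auto simp: in_gap_def)
  finally show ?thesis by (simp only: le_less) blast
qed

lemma associated_digraph_down_iff:
  assumes "i < j"
  shows "(j, w, i) \<in> associated_digraph N a R \<longleftrightarrow>
    (\<exists>k<N i j. w = - a i j (k + 1) \<and> (\<forall>x\<in>R. in_gap (a i j) (N i j) k (x $ i - x $ j)))"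
    (is "?L \<longleftrightarrow> ?R")
proof -
  have "?L \<longleftrightarrow> N i j > 0 \<and> w = - a i j 1 \<and> (\<forall>x\<in>R. x $ i - x $ j < a i j 1) \<or>
      (\<exists>k. 1 \<le> k \<and> k < N i j \<and> w = - a i j (k + 1) \<and>
        (\<forall>x\<in>R. a i j k < x $ i - x $ j \<and> x $ i - x $ j < a i j (k + 1)))" (is "_ \<longleftrightarrow> ?B \<or> ?M")
    using assms less_not_sym[OF assms] by (simp add: associated_digraph_iff)
  also have "?B \<longleftrightarrow> (\<exists>k. k = 0 \<and> k < N i j \<and> w = - a i j (k + 1) \<and>
      (\<forall>x\<in>R. in_gap (a i j) (N i j) k (x $ i - x $ j)))"
    by (auto simp: in_gap_def)
  also have "?M \<longleftrightarrow> (\<exists>k. 1 \<le> k \<and> k < N i j \<and> w = - a i j (k + 1) \<and>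
      (\<forall>x\<in>R. in_gap (a i j) (N i j) k (x $ i - x $ j)))"
    by (intro ex_cong1) (auto simp: in_gap_def)
  finally show ?thesis by (metis One_nat_def Suc_leI not_gr_zero)
qed

lemma associated_digraph_loopfree: "(i, w, i) \<notin> associated_digraph N a R"
  by (simp add: associated_digraph_iff)

lemma weights_between_associated_digraph:
  assumes mono: "strict_mono_on {1..N i j} (a i j)" and "i < j" and "R \<noteq> {}"
    and gap: "\<forall>x\<in>R. in_gap (a i j) (N i j) k (x $ i - x $ j)"
  shows "weights_between (associated_digraph N a R) i j = (if k = 0 then {} else {a i j k})"
    and "weights_between (associated_digraph N a R) j i =
      (if k < N i j then {- a i j (k + 1)} else {})"
proof -
  have uniq: "(\<forall>x\<in>R. in_gap (a i j) (N i j) l (x $ i - x $ j)) \<longleftrightarrow> l = k" for l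
    using gap \<open>R \<noteq> {}\<close> in_gap_unique[OF mono] by blast
  have "k \<le> N i j" using gap \<open>R \<noteq> {}\<close> by (auto simp: in_gap_def)
  then show "weights_between (associated_digraph N a R) i j = (if k = 0 then {} else {a i j k})"
    unfolding weights_between_def associated_digraph_up_iff[OF \<open>i < j\<close>] uniq by auto
  show "weights_between (associated_digraph N a R) j i =
      (if k < N i j then {- a i j (k + 1)} else {})"
    unfolding weights_between_def associated_digraph_down_iff[OF \<open>i < j\<close>] uniq by auto
qed

section \<open>Regions as solution sets\<close>

definition increasing_walls ::
  "('n::{finite,linorder} \<Rightarrow> 'n \<Rightarrow> nat) \<Rightarrow> ('n \<Rightarrow> 'n \<Rightarrow> nat \<Rightarrow> real) \<Rightarrow> bool" where
  "increasing_walls N a \<longleftrightarrow> (\<forall>i j. i < j \<longrightarrow> strict_mono_on {1..N i j} (a i j))"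

text \<open>
  The gaps belonging to one pair of indices are disjoint, so a nonempty set determines the gaps its
  points share, and with them the only loop-free valid digraph that all its points can solve.
\<close>

lemma associated_digraph_eqI:
  assumes mono: "increasing_walls N a" and "R \<noteq> {}" and "R \<subseteq> solutions D"
    and "loopfree_digraph (weighted_digraph D)" and "valid N a D"
  shows "associated_digraph N a R = D"
proof -
  let ?E = "associated_digraph N a R"
  have pair: "weights_between ?E i j = weights_between D i j \<and>
      weights_between ?E j i = weights_between D j i" if ij: "i < j" for i j
  proof -
    obtain k where k: "weights_between D i j = (if k = 0 then {} else {a i j k})"
      "weights_between D j i = (if k < N i j then {- a i j (k + 1)} else {})"
      "\<forall>x\<in>solutions D. in_gap (a i j) (N i j) k (x $ i - x $ j)"
      using valid_gap[OF \<open>valid N a D\<close> ij] by blast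
    moreover have "strict_mono_on {1..N i j} (a i j)"
      using mono ij by (simp add: increasing_walls_def)
    moreover have "\<forall>x\<in>R. in_gap (a i j) (N i j) k (x $ i - x $ j)"
      using k(3) assms(3) by blast
    ultimately show ?thesis
      using weights_between_associated_digraph[where N = N and a = a and i = i and j = j and R = R]
        ij \<open>R \<noteq> {}\<close> by simp
  qed
  have "(i, w, j) \<in> ?E \<longleftrightarrow> (i, w, j) \<in> D" for i w j
  proof (cases "i = j")
    case True
    then show ?thesis
      using assms(4) by (simp add: loopfree_weighted_digraph_iff associated_digraph_loopfree)
  next
    case False
    then have "weights_between ?E i j = weights_between D i j"
      using pair[of i j] pair[of j i] by (cases "i < j") auto
    then show ?thesis by (auto simp: weights_between_def)
  qed
  then show ?thesis by auto
qed

lemma point_solves_valid_digraph: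
  assumes mono: "increasing_walls N a" and x: "x \<in> arrangement_complement N a"
  obtains D where "loopfree_digraph (weighted_digraph D)" and "valid N a D" and "x \<in> solutions D"
proof
  let ?D = "associated_digraph N a {x}"
  show "loopfree_digraph (weighted_digraph ?D)"
    by (simp add: loopfree_weighted_digraph_iff associated_digraph_loopfree)
  show "valid N a ?D"
    unfolding valid_iff_gaps
  proof (intro allI impI)
    fix i j :: 'a assume "i < j"
    then have m: "strict_mono_on {1..N i j} (a i j)" using mono by (simp add: increasing_walls_def)
    obtain k where k: "in_gap (a i j) (N i j) k (x $ i - x $ j)"
      using in_gap_exists x \<open>i < j\<close> unfolding arrangement_complement_iff by blast
    then have "k \<le> N i j" by (simp add: in_gap_def)
    then show "\<exists>k\<le>N i j. weights_between ?D i j = (if k = 0 then {} else {a i j k}) \<and>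
        weights_between ?D j i = (if k < N i j then {- a i j (k + 1)} else {})"
      using weights_between_associated_digraph[where N = N and a = a and i = i and j = j
          and R = "{x}" and k = k] m \<open>i < j\<close> k by (intro exI[of _ k]) simp
  qed
  have "w < x $ i - x $ j" if e: "(i, w, j) \<in> ?D" for i w j
  proof -
    consider "i < j" | "j < i" | "i = j" by fastforce
    then show ?thesis
    proof cases
      case 1
      then show ?thesis using e by (auto simp: associated_digraph_up_iff in_gap_def)
    next
      case 2
      then show ?thesis using e by (fastforce simp: associated_digraph_down_iff in_gap_def)
    next
      case 3
      then show ?thesis using e associated_digraph_loopfree by blast
    qed
  qed
  then show "x \<in> solutions ?D" using x by (auto simp: solutions_def)
qed

lemma solutions_subset_arrangement_complement:
  assumes mono: "increasing_walls N a" and "valid N a D"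
  shows "solutions D \<subseteq> arrangement_complement N a"
proof
  fix x assume x: "x \<in> solutions D"
  have "x $ i - x $ j \<noteq> a i j k" if "i < j" "k \<in> {1..N i j}" for i j k
  proof -
    obtain l where "in_gap (a i j) (N i j) l (x $ i - x $ j)"
      using valid_gap[OF \<open>valid N a D\<close> \<open>i < j\<close>] x by blast
    moreover have "strict_mono_on {1..N i j} (a i j)"
      using mono that by (simp add: increasing_walls_def)
    ultimately show ?thesis using in_gap_less_iff(2) that(2) by metis
  qed
  then show "x \<in> arrangement_complement N a"
    using x unfolding arrangement_complement_iff by (auto simp: solutions_def)
qed

lemma convex_solutions: "convex (solutions D)"
proof (rule convexI)
  fix x y :: "real ^ 'a" and u v :: real
  assume x: "x \<in> solutions D" and y: "y \<in> solutions D" and uv: "0 \<le> u" "0 \<le> v" "u + v = 1"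
  let ?z = "u *\<^sub>R x + v *\<^sub>R y"
  have "(\<Sum>i\<in>UNIV. ?z $ i) = u * (\<Sum>i\<in>UNIV. x $ i) + v * (\<Sum>i\<in>UNIV. y $ i)"
    by (simp add: sum.distrib sum_distrib_left)
  then have "?z \<in> sum_zero_space" using x y by (simp add: solutions_def sum_zero_space_def)
  moreover have "w < ?z $ i - ?z $ j" if "(i, w, j) \<in> D" for i w j
  proof -
    have "w < x $ i - x $ j" "w < y $ i - y $ j" using x y that by (auto simp: solutions_def)
    then have "- (x $ i - x $ j) < - w" "- (y $ i - y $ j) < - w" by auto
    then have "u * - (x $ i - x $ j) + v * - (y $ i - y $ j) < - w"
      using uv by (rule convex_bound_lt)
    then show ?thesis by (simp add: algebra_simps)
  qed
  ultimately show "?z \<in> solutions D" by (simp add: solutions_def)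
qed

text \<open>
  Along a connected set off the hyperplanes no difference of coordinates can cross the weight of an
  edge, because every weight of a valid digraph is, up to sign, the position of a hyperplane.
\<close>

lemma connected_subset_solutions:
  fixes D :: "'n::{finite,linorder} weighted_edges"
  assumes conn: "Topological_Spaces.connected C" and C: "C \<subseteq> arrangement_complement N a"
    and x: "x \<in> C" "x \<in> solutions D"
    and loopfree: "loopfree_digraph (weighted_digraph D)" and valid: "valid N a D"
  shows "C \<subseteq> solutions D"
proof
  fix y assume y: "y \<in> C"
  have "w < y $ i - y $ j" if e: "(i, w, j) \<in> D" for i w j
  proof -
    let ?g = "\<lambda>z::(real, 'n) vec. z $ i - z $ j"
    have wall: "?g z \<noteq> w" if z: "z \<in> C" for z
    proof -
      have "z \<in> arrangement_complement N a" using z C by (rule rev_subsetD)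
      then have off: "z $ p - z $ q \<noteq> a p q k" if "p < q" "1 \<le> k" "k \<le> N p q" for p q k
        using that unfolding arrangement_complement_iff by simp
      consider "i < j" | "j < i" | "i = j" by fastforce
      then show ?thesis
      proof cases
        case 1
        then obtain k where "k \<le> N i j" "weights_between D i j = (if k = 0 then {} else {a i j k})"
          using valid unfolding valid_iff_gaps by blast
        moreover have "w \<in> weights_between D i j" using e by (simp add: weights_between_def)
        ultimately have "1 \<le> k" "k \<le> N i j" "w = a i j k" by (auto split: if_splits)
        then show ?thesis using off[of i j k] 1 by simp
      next
        case 2
        then obtain k where "weights_between D i j = (if k < N j i then {- a j i (k + 1)} else {})"
          using valid unfolding valid_iff_gaps by blast
        moreover have "w \<in> weights_between D i j" using e by (simp add: weights_between_def)
        ultimately have "k < N j i" "w = - a j i (k + 1)" by (auto split: if_splits)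
        then show ?thesis using off[of j i "k + 1"] 2 by auto
      next
        case 3
        then show ?thesis using e loopfree by (simp add: loopfree_weighted_digraph_iff)
      qed
    qed
    have "Topological_Spaces.connected (?g ` C)"
      by (intro connected_continuous_image conn continuous_intros)
    moreover have "w < ?g x" using x(2) e by (auto simp: solutions_def)
    ultimately have "w \<in> ?g ` C" if "?g y \<le> w"
      using connectedD_interval[of "?g ` C" "?g y" "?g x" w] that x(1) y by force
    then show ?thesis using wall by fastforce
  qed
  then show "y \<in> solutions D" using y C by (auto simp: solutions_def)
qed

lemma connected_component_eq_solutions:
  assumes "increasing_walls N a" and "x \<in> solutions D"
    and "loopfree_digraph (weighted_digraph D)" and "valid N a D"
  shows "connected_component_set (arrangement_complement N a) x = solutions D"
proof (rule connected_component_unique)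
  show "solutions D \<subseteq> arrangement_complement N a"
    using assms by (intro solutions_subset_arrangement_complement)
  show "Topological_Spaces.connected (solutions D)"
    by (intro convex_connected convex_solutions)
  show "C \<subseteq> solutions D"
    if "x \<in> C" "C \<subseteq> arrangement_complement N a" "Topological_Spaces.connected C" for C
    using connected_subset_solutions[OF that(3,2,1) assms(2-4)] .
qed (use assms in simp)

lemma regions_eq_solution_sets:
  assumes "increasing_walls N a"
  shows "regions N a =
    {solutions D | D. loopfree_digraph (weighted_digraph D) \<and> valid N a D \<and> solutions D \<noteq> {}}"
    (is "_ = ?S")
proof (intro equalityI subsetI)
  fix R assume "R \<in> regions N a"
  then obtain x where x: "x \<in> arrangement_complement N a"
    "R = connected_component_set (arrangement_complement N a) x"
    unfolding regions_def components_iff by blast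
  obtain D where D: "loopfree_digraph (weighted_digraph D)" "valid N a D" "x \<in> solutions D"
    using point_solves_valid_digraph[OF assms x(1)] .
  then have "R = solutions D" using connected_component_eq_solutions[OF assms D(3,1,2)] x(2) by simp
  then show "R \<in> ?S" using D by blast
next
  fix R assume "R \<in> ?S"
  then obtain D x where D: "R = solutions D" "loopfree_digraph (weighted_digraph D)" "valid N a D"
    "x \<in> solutions D" by blast
  have "x \<in> arrangement_complement N a"
    using solutions_subset_arrangement_complement[OF assms D(3)] D(4) by (rule subsetD)
  moreover have "R = connected_component_set (arrangement_complement N a) x"
    using connected_component_eq_solutions[OF assms D(4,2,3)] D(1) by simp
  ultimately show "R \<in> regions N a" unfolding regions_def components_iff by blast
qed

section \<open>Solvability and negative cycles\<close>

text \<open>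
  The inequalities of the edges telescope along a walk. The strict form excludes closed walks of
  nonnegative weight; the weak one, which also covers the empty walk, bounds differences of
  coordinates.
\<close>

lemma solution_walk_weight:
  assumes "pre_digraph.awalk (weighted_digraph D) u p v" and "x \<in> solutions D"
  shows "(\<Sum>e\<leftarrow>p. edge_weight e) \<le> x $ u - x $ v"
    and "p \<noteq> [] \<Longrightarrow> (\<Sum>e\<leftarrow>p. edge_weight e) < x $ u - x $ v"
proof -
  interpret wf_digraph "weighted_digraph D" by (rule wf_weighted_digraph)
  have "(\<Sum>e\<leftarrow>p. edge_weight e) \<le> x $ u - x $ v \<and>
    (p \<noteq> [] \<longrightarrow> (\<Sum>e\<leftarrow>p. edge_weight e) < x $ u - x $ v)"
    using assms(1)
  proof (induction p arbitrary: u)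
    case Nil
    then show ?case by (simp add: awalk_Nil_iff)
  next
    case (Cons e p)
    obtain i w j where e: "e = (i, w, j)" by (cases e)
    have "(i, w, j) \<in> D" "u = i" and walk: "awalk j p v"
      using Cons.prems by (auto simp: awalk_Cons_iff e)
    then have "w < x $ u - x $ j" using assms(2) by (auto simp: solutions_def)
    then show ?case using Cons.IH[OF walk] by (simp add: e edge_weight_def)
  qed
  then show "(\<Sum>e\<leftarrow>p. edge_weight e) \<le> x $ u - x $ v"
    and "p \<noteq> [] \<Longrightarrow> (\<Sum>e\<leftarrow>p. edge_weight e) < x $ u - x $ v" by auto
qed

lemma solvable_imp_m_acyclic:
  assumes "x \<in> solutions D"
  shows "m_acyclic D"
  unfolding m_acyclic_def pre_digraph.cycle_def using solution_walk_weight(2)[OF _ assms] by fastforce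

lemma finite_valid_digraph:
  fixes D :: "'n::{finite,linorder} weighted_edges"
  assumes "loopfree_digraph (weighted_digraph D)" and "valid N a D"
  shows "finite D"
proof -
  have "finite (weights_between D i j)" for i j
  proof -
    have "finite (weights_between D i j) \<and> finite (weights_between D j i)" if "i < j" for i j
      using assms(2) that unfolding valid_iff_gaps by (metis finite.emptyI finite.insertI)
    moreover have "weights_between D i i = {}"
      using assms(1) by (simp add: weights_between_def loopfree_weighted_digraph_iff)
    ultimately show ?thesis by (cases i j rule: linorder_cases) auto
  qed
  moreover have "D \<subseteq> (\<Union>i. \<Union>j. (\<lambda>w. (i, w, j)) ` weights_between D i j)"
    by (auto simp: weights_between_def)
  ultimately show ?thesis by (meson finite_UN_I finite finite_imageI finite_subset)
qed

text \<open>
  The potential of \<open>i\<close> is the maximal weight of a simple path from \<open>i\<close>, all weights being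
  raised by \<open>\<epsilon>\<close>. Prepending an edge to an optimal simple path either gives a simple path, or
  closes a cycle; a cycle has negative raised weight, so that cutting it off only improves the path.
  The raise by \<open>\<epsilon>\<close> is what makes the resulting inequalities strict.
\<close>

lemma m_acyclic_imp_potential:
  fixes D :: "'n::finite weighted_edges"
  assumes "finite D" and "m_acyclic D"
  shows "\<exists>f :: 'n \<Rightarrow> real. \<forall>i w j. (i, w, j) \<in> D \<longrightarrow> w < f i - f j"
proof -
  interpret wf_digraph "weighted_digraph D" by (rule wf_weighted_digraph)
  interpret fin_digraph "weighted_digraph D"
    by unfold_locales (use \<open>finite D\<close> in auto)
  define C where "C = {e # p | e p i w j. e \<in> D \<and> e = (i, w, j) \<and> apath j p i}"
  have "finite C"
  proof -
    have "C \<subseteq> (\<lambda>(e, u, p, v). e # p) ` (D \<times> {(u, p, v). apath u p v})"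
      unfolding C_def by force
    then show ?thesis using \<open>finite D\<close> apaths_finite_triple by (meson finite_SigmaI finite_imageI finite_subset)
  qed
  have cycle_neg: "(\<Sum>e\<leftarrow>c. edge_weight e) < 0" if c_in: "c \<in> C" for c
  proof -
    obtain p i w j where c: "c = (i, w, j) # p" "(i, w, j) \<in> D" "apath j p i"
      using c_in unfolding C_def by blast
    have "awalk i c i" "distinct (tl (awalk_verts i c))"
      using c by (auto simp: awalk_Cons_iff apath_def)
    then have "cycle c" using c unfolding cycle_def by blast
    then show ?thesis using \<open>m_acyclic D\<close> unfolding m_acyclic_def by fastforce
  qed
  have "eventually (\<lambda>\<epsilon>. \<forall>c\<in>C. (\<Sum>e\<leftarrow>c. edge_weight e) + \<epsilon> * length c < 0) (at_right (0::real))"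
  proof (intro eventually_ball_finite \<open>finite C\<close> ballI)
    fix c assume "c \<in> C"
    have "((\<lambda>\<epsilon>::real. (\<Sum>e\<leftarrow>c. edge_weight e) + \<epsilon> * length c) \<longlongrightarrow>
        (\<Sum>e\<leftarrow>c. edge_weight e) + 0 * real (length c)) (at_right 0)"
      by (intro tendsto_intros)
    then show "eventually (\<lambda>\<epsilon>. (\<Sum>e\<leftarrow>c. edge_weight e) + \<epsilon> * length c < 0) (at_right (0::real))"
      using cycle_neg[OF \<open>c \<in> C\<close>] by (intro order_tendstoD(2)) auto
  qed
  then have "eventually (\<lambda>\<epsilon>. (\<forall>c\<in>C. (\<Sum>e\<leftarrow>c. edge_weight e) + \<epsilon> * length c < 0) \<and> \<epsilon> > 0)
      (at_right (0::real))"
    by (intro eventually_conj eventually_at_right_less)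
  then obtain \<epsilon> :: real where eps: "\<epsilon> > 0"
    "\<forall>c\<in>C. (\<Sum>e\<leftarrow>c. edge_weight e) + \<epsilon> * length c < 0"
    using eventually_happens'[OF trivial_limit_at_right_real] by blast
  define W where "W p = (\<Sum>e\<leftarrow>p. edge_weight e) + \<epsilon> * length p" for p :: "('n \<times> real \<times> 'n) list"
  have W_Cons: "W (e # p) = edge_weight e + \<epsilon> + W p" and W_append: "W (p @ q) = W p + W q" for e p q
    by (auto simp: W_def algebra_simps)
  define P where "P u = {p. \<exists>v. apath u p v}" for u
  have P: "finite (P u)" "P u \<noteq> {}" for u
  proof -
    have "P u \<subseteq> (\<lambda>(u, p, v). p) ` {(u, p, v). apath u p v}" unfolding P_def by force
    then show "finite (P u)" using apaths_finite_triple by (meson finite_imageI finite_subset)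
    have "apath u [] u" by (simp add: apath_Nil_iff)
    then show "P u \<noteq> {}" unfolding P_def by blast
  qed
  define f where "f u = Max (W ` P u)" for u
  have f_ge: "W p \<le> f u" if "apath u p v" for u p v
    unfolding f_def using that P by (intro Max_ge) (auto simp: P_def)
  have "w < f i - f j" if e: "(i, w, j) \<in> D" for i w j
  proof -
    have "f j \<in> W ` P j" unfolding f_def using P by (intro Max_in) auto
    then obtain p v where p: "apath j p v" "f j = W p" unfolding P_def by blast
    have "w + \<epsilon> + W p \<le> f i"
    proof (cases "i \<in> set (awalk_verts j p)")
      case False
      then have "apath i ((i, w, j) # p) v"
        using p e by (simp add: apath_Cons_iff)
      then show ?thesis using f_ge W_Cons by (fastforce simp: edge_weight_def)
    next
      case True
      then obtain q r where qr: "p = q @ r" "awalk j q i" "awalk i r v"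
        using awalk_decomp p(1) unfolding apath_def by blast
      then have "awlast j q = i" by auto
      then have "apath j q i" "apath i r v" using p(1) qr(1) apath_append_iff[of j q r v] by auto
      then have "(i, w, j) # q \<in> C" using e unfolding C_def by blast
      then have "W ((i, w, j) # q) < 0" using eps(2) by (auto simp: W_def)
      then have "w + \<epsilon> + W p < W r" by (simp add: W_Cons W_append qr(1) edge_weight_def)
      also have "W r \<le> f i" using f_ge \<open>apath i r v\<close> .
      finally show ?thesis by simp
    qed
    then show ?thesis using eps(1) p(2) by simp
  qed
  then show ?thesis by blast
qed

text \<open>
  Only differences of coordinates matter, so subtracting the mean moves a potential into the space
  of vectors with coordinate sum zero.
\<close>

lemma m_acyclic_imp_solvable:
  fixes D :: "'n::finite weighted_edges"
  assumes "finite D" and "m_acyclic D"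
  shows "solutions D \<noteq> {}"
proof -
  obtain f :: "'n \<Rightarrow> real" where f: "\<forall>i w j. (i, w, j) \<in> D \<longrightarrow> w < f i - f j"
    using m_acyclic_imp_potential[OF assms] by blast
  define x :: "real ^ 'n" where "x = (\<chi> i. f i - (\<Sum>j\<in>UNIV. f j) / CARD('n))"
  have "x \<in> sum_zero_space" by (simp add: sum_zero_space_def x_def sum_subtractf)
  then have "x \<in> solutions D" using f by (simp add: solutions_def x_def)
  then show ?thesis by blast
qed

section \<open>Boundedness and strong connectivity\<close>

lemma strongly_connected_imp_bounded:
  fixes D :: "'n::finite weighted_edges"
  assumes "strongly_connected (weighted_digraph D)"
  shows "bounded (solutions D)"
proof -
  interpret wf_digraph "weighted_digraph D" by (rule wf_weighted_digraph)
  have "\<exists>c. \<forall>x\<in>solutions D. c \<le> x $ i - x $ j" for i j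
  proof -
    have "i \<rightarrow>\<^sup>*\<^bsub>weighted_digraph D\<^esub> j"
      using assms by (simp add: strongly_connected_def)
    then obtain p where "awalk i p j" using reachable_awalk by blast
    then show ?thesis using solution_walk_weight(1) by blast
  qed
  then obtain c where c: "\<And>i j x. x \<in> solutions D \<Longrightarrow> c i j \<le> x $ i - x $ j" by metis
  define B where "B = (\<Sum>i\<in>UNIV. \<Sum>j\<in>UNIV. \<bar>c i j\<bar> + \<bar>c j i\<bar>)"
  have "norm x \<le> B" if x: "x \<in> solutions D" for x
  proof -
    have "\<bar>x $ i\<bar> \<le> (\<Sum>j\<in>UNIV. \<bar>c i j\<bar> + \<bar>c j i\<bar>)" for i
    proof -
      \<comment> \<open>The coordinates sum to zero, so each coordinate is the mean of its differences to all.\<close>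
      have "(\<Sum>j\<in>UNIV. x $ j) = 0" using x by (simp add: solutions_def sum_zero_space_def)
      then have "(\<Sum>j\<in>UNIV. x $ i - x $ j) = CARD('n) * x $ i" by (simp add: sum_subtractf)
      moreover have "\<bar>x $ i\<bar> \<le> \<bar>CARD('n) * x $ i\<bar>"
        by (simp add: abs_mult mult_le_cancel_right1 Suc_leI)
      moreover have "\<bar>\<Sum>j\<in>UNIV. x $ i - x $ j\<bar> \<le> (\<Sum>j\<in>UNIV. \<bar>x $ i - x $ j\<bar>)"
        by (rule sum_abs)
      moreover have "(\<Sum>j\<in>UNIV. \<bar>x $ i - x $ j\<bar>) \<le> (\<Sum>j\<in>UNIV. \<bar>c i j\<bar> + \<bar>c j i\<bar>)"
      proof (rule sum_mono)
        fix j
        show "\<bar>x $ i - x $ j\<bar> \<le> \<bar>c i j\<bar> + \<bar>c j i\<bar>"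
          using c[OF x, of i j] c[OF x, of j i] by linarith
      qed
      ultimately show ?thesis by linarith
    qed
    then have "(\<Sum>i\<in>UNIV. \<bar>x $ i\<bar>) \<le> B" unfolding B_def by (intro sum_mono)
    then show ?thesis using norm_le_l1_cart[of x] by linarith
  qed
  then show ?thesis unfolding bounded_iff by blast
qed

text \<open>
  The set of vertices reachable from \<open>u\<close> has no outgoing edges, so its coordinates occur only
  negatively in the inequalities that connect it to its complement. If it misses a vertex, moving it
  down against its complement is therefore a direction of unboundedness.
\<close>

lemma bounded_imp_strongly_connected:
  fixes D :: "'n::finite weighted_edges"
  assumes "bounded (solutions D)" and "solutions D \<noteq> {}"
  shows "strongly_connected (weighted_digraph D)"
proof (rule ccontr)
  interpret wf_digraph "weighted_digraph D" by (rule wf_weighted_digraph)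
  assume "\<not> strongly_connected (weighted_digraph D)"
  then obtain u v where uv: "\<not> u \<rightarrow>\<^sup>*\<^bsub>weighted_digraph D\<^esub> v"
    by (auto simp: strongly_connected_def)
  define S where "S = {i. u \<rightarrow>\<^sup>*\<^bsub>weighted_digraph D\<^esub> i}"
  have "u \<in> S" by (simp add: S_def)
  have "v \<notin> S" using uv by (simp add: S_def)
  have closed: "j \<in> S" if "(i, w, j) \<in> D" "i \<in> S" for i w j
  proof -
    have "awalk i [(i, w, j)] j" using that(1) by (simp add: awalk_simps)
    then show ?thesis using that(2) reachable_awalkI reachable_trans unfolding S_def by blast
  qed
  \<comment> \<open>The sizes of the two parts are chosen as speeds to keep the coordinate sum zero.\<close>
  define d :: "real ^ 'n" where "d = (\<chi> i. if i \<in> S then - real (card (- S)) else real (card S))"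
  have d_sum: "(\<Sum>i\<in>UNIV. d $ i) = 0"
    by (simp add: d_def sum.If_cases)
  have d_edge: "d $ j \<le> d $ i" if "(i, w, j) \<in> D" for i w j
    using closed[OF that] by (auto simp: d_def)
  have d_v: "1 \<le> d $ v"
    using \<open>u \<in> S\<close> \<open>v \<notin> S\<close> by (auto simp: d_def Suc_le_eq card_gt_0_iff)
  obtain x where x: "x \<in> solutions D" using assms(2) by blast
  have ray: "x + t *\<^sub>R d \<in> solutions D" if "t \<ge> 0" for t
  proof -
    have "w < (x + t *\<^sub>R d) $ i - (x + t *\<^sub>R d) $ j" if e: "(i, w, j) \<in> D" for i w j
    proof -
      have "w < x $ i - x $ j" using x e by (auto simp: solutions_def)
      moreover have "t * d $ j \<le> t * d $ i" using d_edge[OF e] \<open>t \<ge> 0\<close> by (rule mult_left_mono)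
      ultimately show ?thesis by simp
    qed
    moreover have "x + t *\<^sub>R d \<in> sum_zero_space"
      using x d_sum
      by (simp add: solutions_def sum_zero_space_def sum.distrib sum_distrib_left[symmetric])
    ultimately show ?thesis by (simp add: solutions_def)
  qed
  obtain B where B: "\<And>y. y \<in> solutions D \<Longrightarrow> norm y \<le> B"
    using assms(1) unfolding bounded_iff by blast
  define t where "t = \<bar>B\<bar> + \<bar>x $ v\<bar> + 1"
  have "t * 1 \<le> t * d $ v" using d_v by (intro mult_left_mono) (auto simp: t_def)
  then have "B < (x + t *\<^sub>R d) $ v" by (simp add: t_def)
  also have "\<dots> \<le> norm (x + t *\<^sub>R d)" using component_le_norm_cart[of "x + t *\<^sub>R d" v] by linarith
  also have "\<dots> \<le> B" by (intro B ray) (simp add: t_def)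
  finally show False by simp
qed

section \<open>The bijection\<close>

theorem corollary2p15:
  fixes G :: "'n::{finite,linorder} pair_pre_digraph"
    and N :: "'n \<Rightarrow> 'n \<Rightarrow> nat"
    and a :: "'n \<Rightarrow> 'n \<Rightarrow> nat \<Rightarrow> real"
  assumes "graphical_deformation G N a"
  shows "bij_betw (associated_digraph N a) (regions N a)
           {D. loopfree_digraph (weighted_digraph D) \<and> valid N a D \<and> m_acyclic D} \<and>
         (\<forall>R\<in>regions N a.
            bounded R \<longleftrightarrow> strongly_connected (weighted_digraph (associated_digraph N a R)))"
proof -
  have walls: "increasing_walls N a"
    using assms unfolding graphical_deformation_def increasing_walls_def by blast
  define T where "T = {D. loopfree_digraph (weighted_digraph D) \<and> valid N a D \<and> m_acyclic D}"
  have solvable_iff: "solutions D \<noteq> {} \<longleftrightarrow> m_acyclic D"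
    if "loopfree_digraph (weighted_digraph D)" "valid N a D" for D
    using m_acyclic_imp_solvable[OF finite_valid_digraph[OF that]] solvable_imp_m_acyclic by auto
  have "regions N a = {solutions D | D. D \<in> T}"
    unfolding regions_eq_solution_sets[OF walls] T_def mem_Collect_eq
    by (simp only: solvable_iff cong: conj_cong)
  then have regions: "regions N a = solutions ` T" by (simp only: image_def) blast
  have nonempty: "solutions D \<noteq> {}" if "D \<in> T" for D
    using that solvable_iff by (simp add: T_def)
  have inverse: "associated_digraph N a (solutions D) = D" if "D \<in> T" for D
    using associated_digraph_eqI[OF walls nonempty[OF that] subset_refl] that by (simp add: T_def)
  have "bij_betw (associated_digraph N a) (regions N a) T"
    unfolding regions
    by (rule bij_betw_byWitness[where f' = solutions]) (auto simp: inverse)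
  moreover have "bounded R \<longleftrightarrow> strongly_connected (weighted_digraph (associated_digraph N a R))"
    if R: "R \<in> regions N a" for R
  proof -
    obtain D where D: "D \<in> T" "R = solutions D" using R unfolding regions by blast
    have "bounded (solutions D) \<longleftrightarrow> strongly_connected (weighted_digraph D)"
      using strongly_connected_imp_bounded bounded_imp_strongly_connected[OF _ nonempty[OF D(1)]]
      by (rule iffI[rotated])
    then show ?thesis using D inverse by simp
  qed
  ultimately show ?thesis unfolding T_def by blast
qed

end
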